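(* Let $(\mathscr G,\mathscr H)$ and $(\mathscr E,\mathscr K)$ be Friedrichs modules and let $D\in\mathcal B(\mathscr G,\mathscr E)$. Let $a,c\in\mathcal B(\mathscr E,\mathscr E^* )$ be such that, for some strictly positive constants $\mu,\nu$ and all $u\in\mathscr G$, $$\mathrm{Re}\,\langle Du,aDu\rangle\ge\mu\|u\|_{\mathscr G}^2-\nu\|u\|_{\mathscr H}^2,\qquad \mathrm{Re}\,\langle Du,cDu\rangle\ge\mu\|u\|_{\mathscr G}^2-\nu\|u\|_{\mathscr H}^2 .$$ Assume that $$D(\Delta_c-z)^{-1}\in\mathcal B_q^{\,r}(\mathscr H,\mathscr K)\quad\text{and}\quad D(D^*cD-z)^{-1}D^*\in\mathcal B_q^{\,r}(\mathscr K)$$ for some $z$ with $\mathrm{Re}\,z\le-\nu$. If $a-c\in\mathcal B_q^{\,r}(\mathscr K)$ then $$D(\Delta_a-z)^{-1}\in\mathcal B_q^{\,r}(\mathscr H,\mathscr K)\quad\text{and}\quad D(D^*aD-z)^{-1}D^*\in\mathcal B_q^{\,r}(\mathscr K).$$ The same assertion holds with the spaces $\mathcal B_q^{\,r}$ replaced everywhere by $\mathcal B_q^{\,l}$.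
   Context: A Hilbert module is a pair consisting of a Hilbert space $\mathscr H$ and a non-degenerate $C^*$-algebra $\mathcal M(\mathscr H)\subset\mathcal B(\mathscr H)$ (the multiplier algebra), non-degenerate meaning that the linear span of $\{Mu:M\in\mathcal M(\mathscr H),u\in\mathscr H\}$ is dense. A Friedrichs module $(\mathscr G,\mathscr H)$ consists of a Hilbert module $\mathscr H$ and a Hilbert space $\mathscr G\subset\mathscr H$, embedded continuously and densely. $\mathscr G^*$ is the space of antilinear continuous forms on $\mathscr G$; identifying $\mathscr H^*=\mathscr H$ gives $\mathscr G\subset\mathscr H\subset\mathscr G^*$ with $\langle\cdot,\cdot\rangle$ extending the scalar product of $\mathscr H$. Likewise $\mathscr E\subset\mathscr K\subset\mathscr E^*$; then $\mathcal B(\mathscr K)\subset\mathcal B(\mathscr E,\mathscr E^* )$ (so $a-c\in\mathcal B_q^{\,r}(\mathscr K)$ means that $a-c$ is induced by an operator in $\mathcal B_q^{\,r}(\mathscr K)$), and $D^*\in\mathcal B(\mathscr E^*,\mathscr G^* )$. $D^*aD\in\mathcal B(\mathscr G,\mathscr G^* )$, and for $\mathrm{Re}\,z\le-\nu$ the operator $D^*aD-z:\mathscr G\to\mathscr G^*$ is bijective. $\Delta_a$ is the operator in $\mathscr H$ associated to $D^*aD$, i.e. its restriction to the domain $\{u\in\mathscr G:D^*aDu\in\mathscr H\}$; similarly $\Delta_c$. The operator $D(D^*cD-z)^{-1}D^*:\mathscr E^*\to\mathscr E$ is regarded as an element of $\mathcal B(\mathscr K)$ through $\mathscr K\subset\mathscr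 E^*$, $\mathscr E\subset\mathscr K$; $D(\Delta_c-z)^{-1}$ is regarded as an operator $\mathscr H\to\mathscr K$. Similarly with $a$ in place of $c$. For Hilbert modules $\mathscr H,\mathscr K$: $\mathcal B_0^{\,l}(\mathscr H,\mathscr K)$ (resp. $\mathcal B_0^{\,r}(\mathscr H,\mathscr K)$) is the norm-closed linear span of the operators $NT$ with $N\in\mathcal M(\mathscr K)$ (resp. $TM$ with $M\in\mathcal M(\mathscr H)$), $T\in\mathcal B(\mathscr H,\mathscr K)$. $\mathcal B_q^{\,l}(\mathscr H,\mathscr K)$ is the set of $S\in\mathcal B(\mathscr H,\mathscr K)$ with $SM\in\mathcal B_0^{\,l}(\mathscr H,\mathscr K)$ for all $M\in\mathcal M(\mathscr H)$; $\mathcal B_q^{\,r}(\mathscr H,\mathscr K)$ is the set of $S$ with $NS\in\mathcal B_0^{\,r}(\mathscr H,\mathscr K)$ for all $N\in\mathcal M(\mathscr K)$. $\mathcal B_q^{\,r}(\mathscr K)=\mathcal B_q^{\,r}(\mathscr K,\mathscr K)$, etc. *)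

theory Defs
  imports "HOL-Analysis.Analysis"
begin

section \<open>Complex normed spaces and Hilbert spaces\<close>

class complex_normed_vector = real_normed_vector +
  fixes scaleC :: "complex \<Rightarrow> 'a \<Rightarrow> 'a"  (infixr "*\<^sub>C" 75)
  assumes scaleC_add_right: "c *\<^sub>C (x + y) = c *\<^sub>C x + c *\<^sub>C y"
    and scaleC_add_left: "(c + d) *\<^sub>C x = c *\<^sub>C x + d *\<^sub>C x"
    and scaleC_scaleC: "c *\<^sub>C d *\<^sub>C x = (c * d) *\<^sub>C x"
    and scaleR_scaleC: "r *\<^sub>R x = complex_of_real r *\<^sub>C x"
    and norm_scaleC: "norm (c *\<^sub>C x) = cmod c * norm x"

text \<open>The scalar product is antilinear in the first argument.\<close>

class complex_hilbert_space = complex_normed_vector + complete_space +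
  fixes cinner :: "'a \<Rightarrow> 'a \<Rightarrow> complex"
  assumes cinner_commute: "cinner x y = cnj (cinner y x)"
    and cinner_add_right: "cinner x (y + z) = cinner x y + cinner x z"
    and cinner_scaleC_right: "cinner x (c *\<^sub>C y) = c * cinner x y"
    and cinner_self: "cinner x x = complex_of_real ((norm x)\<^sup>2)"

lemma module_scaleC: "module (scaleC :: complex \<Rightarrow> 'a \<Rightarrow> 'a::complex_normed_vector)"
proof
  fix c d :: complex and x y :: 'a
  show "1 *\<^sub>C x = x" using scaleR_scaleC[of 1 x] by simp
qed (simp_all add: scaleC_add_right scaleC_add_left scaleC_scaleC)

abbreviation cspan :: "'a::complex_normed_vector set \<Rightarrow> 'a set"
  where "cspan \<equiv> module.span scaleC"

abbreviation csubspace :: "'a::complex_normed_vector set \<Rightarrow> bool"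
  where "csubspace \<equiv> module.subspace scaleC"

lemma scaleC_zero_right: "c *\<^sub>C (0::'a::complex_normed_vector) = 0"
  by (rule module.scale_zero_right[OF module_scaleC])

lemma scaleC_minus_right: "c *\<^sub>C (- x) = - (c *\<^sub>C (x::'a::complex_normed_vector))"
  by (rule module.scale_minus_right[OF module_scaleC])

lemma scaleC_diff_right: "c *\<^sub>C (x - y) = c *\<^sub>C x - c *\<^sub>C (y::'a::complex_normed_vector)"
  by (rule module.scale_right_diff_distrib[OF module_scaleC])

lemma scaleC_scaleR_commute:
  "c *\<^sub>C r *\<^sub>R x = r *\<^sub>R c *\<^sub>C (x::'a::complex_normed_vector)"
  by (simp add: scaleR_scaleC scaleC_scaleC mult.commute)

lemma bounded_linear_scaleC_right:
  "bounded_linear (\<lambda>x. c *\<^sub>C (x::'a::complex_normed_vector))"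
  by (rule bounded_linear_intro[where K = "cmod c"])
    (simp_all add: scaleC_add_right scaleC_scaleR_commute norm_scaleC)

instantiation complex :: complex_hilbert_space
begin
definition scaleC_complex :: "complex \<Rightarrow> complex \<Rightarrow> complex"
  where "scaleC_complex c x = c * x"
definition cinner_complex :: "complex \<Rightarrow> complex \<Rightarrow> complex"
  where "cinner_complex x y = cnj x * y"
instance
  by standard
    (simp_all add: scaleC_complex_def cinner_complex_def algebra_simps norm_mult scaleR_conv_of_real
      complex_mult_cnj cmod_power2)
end

lemma cinner_add_left: "cinner (x + y) z = cinner x z + cinner y (z::'a::complex_hilbert_space)"
  using cinner_commute[of "x + y" z] cinner_commute[of x z] cinner_commute[of y z]
  by (simp add: cinner_add_right)

lemma cinner_scaleC_left: "cinner (c *\<^sub>C x) y = cnj c * cinner x (y::'a::complex_hilbert_space)"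
  using cinner_commute[of "c *\<^sub>C x" y] cinner_commute[of x y]
  by (simp add: cinner_scaleC_right)

lemma cinner_zero_left: "cinner 0 (y::'a::complex_hilbert_space) = 0"
  using cinner_add_left[of 0 0 y] by simp

lemma cmod_cinner_le: "cmod (cinner x y) \<le> norm x * norm (y::'a::complex_hilbert_space)"
proof (cases "x = 0")
  case False
  define p where "p = cinner x y"
  define n where "n = complex_of_real ((norm x)\<^sup>2)"
  define w where "w = n *\<^sub>C y + (- p) *\<^sub>C x"
  have yx: "cinner y x = cnj p"
    unfolding p_def by (rule cinner_commute)
  have n: "cinner x x = n" "cnj n = n"
    by (simp_all add: n_def cinner_self)
  have "cinner w w = n * (n * cinner y y - p * cnj p)"
    unfolding w_def
    by (simp add: cinner_add_left cinner_add_right cinner_scaleC_left cinner_scaleC_right yx n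
        algebra_simps flip: p_def)
  also have "\<dots> = complex_of_real ((norm x)\<^sup>2 * ((norm x)\<^sup>2 * (norm y)\<^sup>2 - (cmod p)\<^sup>2))"
    by (simp add: n_def cinner_self flip: complex_norm_square)
  finally have "(norm w)\<^sup>2 = (norm x)\<^sup>2 * ((norm x)\<^sup>2 * (norm y)\<^sup>2 - (cmod p)\<^sup>2)"
    unfolding cinner_self of_real_eq_iff .
  then have "0 \<le> (norm x)\<^sup>2 * ((norm x)\<^sup>2 * (norm y)\<^sup>2 - (cmod p)\<^sup>2)"
    by (metis zero_le_power2)
  then have "(cmod p)\<^sup>2 \<le> (norm x * norm y)\<^sup>2"
    using False by (simp add: zero_le_mult_iff power_mult_distrib)
  then show ?thesis
    unfolding p_def by (rule power2_le_imp_le) simp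
qed (simp add: cinner_zero_left)

lemma bounded_linear_cinner_left: "bounded_linear (\<lambda>x. cinner x (y::'a::complex_hilbert_space))"
  by (rule bounded_linear_intro[where K = "norm y"])
    (simp_all add: cinner_add_left scaleR_scaleC cinner_scaleC_left cmod_cinner_le
      scaleC_complex_def)

lemma bounded_linear_scaleC_blinfun_apply:
  fixes f :: "'a::real_normed_vector \<Rightarrow>\<^sub>L 'b::complex_normed_vector"
  shows "bounded_linear (\<lambda>x. c *\<^sub>C blinfun_apply f x)"
  by (rule bounded_linear_compose[OF bounded_linear_scaleC_right blinfun.bounded_linear_right])

definition blinfun_scaleC ::
    "complex \<Rightarrow> ('a::real_normed_vector \<Rightarrow>\<^sub>L 'b::complex_normed_vector) \<Rightarrow> ('a \<Rightarrow>\<^sub>L 'b)"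
  where "blinfun_scaleC c f = Blinfun (\<lambda>x. c *\<^sub>C blinfun_apply f x)"

lemma blinfun_scaleC_apply: "blinfun_apply (blinfun_scaleC c f) x = c *\<^sub>C blinfun_apply f x"
  by (simp add: blinfun_scaleC_def bounded_linear_Blinfun_apply bounded_linear_scaleC_blinfun_apply)

lemma norm_blinfun_scaleC: "norm (blinfun_scaleC c f) = cmod c * norm f"
proof (rule antisym)
  show le: "norm (blinfun_scaleC c f) \<le> cmod c * norm f" for c and f :: "'a \<Rightarrow>\<^sub>L 'b"
    by (rule norm_blinfun_bound)
      (simp_all add: blinfun_scaleC_apply norm_scaleC mult.assoc mult_left_mono norm_blinfun)
  show "cmod c * norm f \<le> norm (blinfun_scaleC c f)"
  proof (cases "c = 0")
    case False
    have "blinfun_scaleC (inverse c) (blinfun_scaleC c f) = f"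
      using False module.scale_one[OF module_scaleC]
      by (intro blinfun_eqI) (simp add: blinfun_scaleC_apply scaleC_scaleC)
    with le[of "inverse c" "blinfun_scaleC c f"] False show ?thesis
      by (simp add: norm_inverse norm_divide field_simps)
  qed simp
qed

section \<open>Bounded complex-linear operators and continuous antilinear forms\<close>

typedef (overloaded) ('a, 'b) cblinfun =
  "{f :: 'a::complex_normed_vector \<Rightarrow>\<^sub>L 'b::complex_normed_vector.
      \<forall>c x. blinfun_apply f (c *\<^sub>C x) = c *\<^sub>C blinfun_apply f x}"
  by (rule exI[of _ 0]) (simp add: scaleC_zero_right)

typedef (overloaded) 'a antidual =
  "{f :: 'a::complex_normed_vector \<Rightarrow>\<^sub>L complex.
      \<forall>c x. blinfun_apply f (c *\<^sub>C x) = cnj c * blinfun_apply f x}"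
  by (rule exI[of _ 0]) simp

setup_lifting type_definition_cblinfun
setup_lifting type_definition_antidual

lift_definition cblinfun_apply ::
    "('a::complex_normed_vector, 'b::complex_normed_vector) cblinfun \<Rightarrow> 'a \<Rightarrow> 'b"
    (infixr "*\<^sub>V" 70)
  is blinfun_apply .

lift_definition antidual_apply :: "'a::complex_normed_vector antidual \<Rightarrow> 'a \<Rightarrow> complex"
  is blinfun_apply .

text \<open>Both spaces carry the operator norm inherited from the real bounded linear maps.\<close>

instantiation cblinfun :: (complex_normed_vector, complex_normed_vector) complex_normed_vector
begin
lift_definition zero_cblinfun :: "('a, 'b) cblinfun" is 0
  by (simp add: scaleC_zero_right)
lift_definition plus_cblinfun :: "('a, 'b) cblinfun \<Rightarrow> ('a, 'b) cblinfun \<Rightarrow> ('a, 'b) cblinfun" is "(+)"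
  by (simp add: blinfun.add_left scaleC_add_right)
lift_definition minus_cblinfun :: "('a, 'b) cblinfun \<Rightarrow> ('a, 'b) cblinfun \<Rightarrow> ('a, 'b) cblinfun" is "(-)"
  by (simp add: blinfun.diff_left scaleC_diff_right)
lift_definition uminus_cblinfun :: "('a, 'b) cblinfun \<Rightarrow> ('a, 'b) cblinfun" is uminus
  by (simp add: blinfun.minus_left scaleC_minus_right)
lift_definition scaleR_cblinfun :: "real \<Rightarrow> ('a, 'b) cblinfun \<Rightarrow> ('a, 'b) cblinfun" is "(*\<^sub>R)"
  by (simp add: blinfun.scaleR_left scaleC_scaleR_commute)
lift_definition scaleC_cblinfun :: "complex \<Rightarrow> ('a, 'b) cblinfun \<Rightarrow> ('a, 'b) cblinfun" is blinfun_scaleC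
  by (simp add: blinfun_scaleC_apply scaleC_scaleC mult.commute)
lift_definition norm_cblinfun :: "('a, 'b) cblinfun \<Rightarrow> real" is norm .
definition dist_cblinfun :: "('a, 'b) cblinfun \<Rightarrow> ('a, 'b) cblinfun \<Rightarrow> real"
  where "dist_cblinfun S T = norm (S - T)"
definition sgn_cblinfun :: "('a, 'b) cblinfun \<Rightarrow> ('a, 'b) cblinfun"
  where "sgn_cblinfun S = inverse (norm S) *\<^sub>R S"
definition uniformity_cblinfun :: "(('a, 'b) cblinfun \<times> ('a, 'b) cblinfun) filter"
  where "uniformity_cblinfun = (INF e\<in>{0<..}. principal {(S, T). dist S T < e})"
definition open_cblinfun :: "('a, 'b) cblinfun set \<Rightarrow> bool"
  where "open_cblinfun U = (\<forall>S\<in>U. \<forall>\<^sub>F (S', T) in uniformity. S' = S \<longrightarrow> T \<in> U)"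
instance
proof
  fix S T U :: "('a, 'b) cblinfun" and r s :: real and c d :: complex
  show "S + T + U = S + (T + U)" "S + T = T + S" "0 + S = S" "- S + S = 0" "S - T = S + - T"
    "r *\<^sub>R (S + T) = r *\<^sub>R S + r *\<^sub>R T" "(r + s) *\<^sub>R S = r *\<^sub>R S + s *\<^sub>R S"
    "r *\<^sub>R s *\<^sub>R S = (r * s) *\<^sub>R S" "1 *\<^sub>R S = S"
    "norm S = 0 \<longleftrightarrow> S = 0" "norm (r *\<^sub>R S) = \<bar>r\<bar> * norm S"
    by (transfer; simp add: algebra_simps)+
  show "norm (S + T) \<le> norm S + norm T"
    by transfer (rule norm_triangle_ineq)
  show "c *\<^sub>C (S + T) = c *\<^sub>C S + c *\<^sub>C T" "(c + d) *\<^sub>C S = c *\<^sub>C S + d *\<^sub>C S"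
    "c *\<^sub>C d *\<^sub>C S = (c * d) *\<^sub>C S" "r *\<^sub>R S = complex_of_real r *\<^sub>C S"
    by (transfer; auto intro!: blinfun_eqI simp: blinfun_scaleC_apply blinfun.add_left
        blinfun.scaleR_left scaleC_add_right scaleC_add_left scaleC_scaleC scaleR_scaleC)+
  show "norm (c *\<^sub>C S) = cmod c * norm S"
    by transfer (rule norm_blinfun_scaleC)
qed (rule dist_cblinfun_def sgn_cblinfun_def uniformity_cblinfun_def open_cblinfun_def)+
end

instantiation antidual :: (complex_normed_vector) complex_normed_vector
begin
lift_definition zero_antidual :: "'a antidual" is 0
  by simp
lift_definition plus_antidual :: "'a antidual \<Rightarrow> 'a antidual \<Rightarrow> 'a antidual" is "(+)"
  by (simp add: blinfun.add_left algebra_simps)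
lift_definition minus_antidual :: "'a antidual \<Rightarrow> 'a antidual \<Rightarrow> 'a antidual" is "(-)"
  by (simp add: blinfun.diff_left algebra_simps)
lift_definition uminus_antidual :: "'a antidual \<Rightarrow> 'a antidual" is uminus
  by (simp add: blinfun.minus_left)
lift_definition scaleR_antidual :: "real \<Rightarrow> 'a antidual \<Rightarrow> 'a antidual" is "(*\<^sub>R)"
  by (simp add: blinfun.scaleR_left)
lift_definition scaleC_antidual :: "complex \<Rightarrow> 'a antidual \<Rightarrow> 'a antidual" is blinfun_scaleC
  by (simp add: blinfun_scaleC_apply scaleC_complex_def)
lift_definition norm_antidual :: "'a antidual \<Rightarrow> real" is norm .
definition dist_antidual :: "'a antidual \<Rightarrow> 'a antidual \<Rightarrow> real"
  where "dist_antidual f g = norm (f - g)"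
definition sgn_antidual :: "'a antidual \<Rightarrow> 'a antidual"
  where "sgn_antidual f = inverse (norm f) *\<^sub>R f"
definition uniformity_antidual :: "('a antidual \<times> 'a antidual) filter"
  where "uniformity_antidual = (INF e\<in>{0<..}. principal {(f, g). dist f g < e})"
definition open_antidual :: "'a antidual set \<Rightarrow> bool"
  where "open_antidual U = (\<forall>f\<in>U. \<forall>\<^sub>F (f', g) in uniformity. f' = f \<longrightarrow> g \<in> U)"
instance
proof
  fix f g h :: "'a antidual" and r s :: real and c d :: complex
  show "f + g + h = f + (g + h)" "f + g = g + f" "0 + f = f" "- f + f = 0" "f - g = f + - g"
    "r *\<^sub>R (f + g) = r *\<^sub>R f + r *\<^sub>R g" "(r + s) *\<^sub>R f = r *\<^sub>R f + s *\<^sub>R f"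
    "r *\<^sub>R s *\<^sub>R f = (r * s) *\<^sub>R f" "1 *\<^sub>R f = f"
    "norm f = 0 \<longleftrightarrow> f = 0" "norm (r *\<^sub>R f) = \<bar>r\<bar> * norm f"
    by (transfer; simp add: algebra_simps)+
  show "norm (f + g) \<le> norm f + norm g"
    by transfer (rule norm_triangle_ineq)
  show "c *\<^sub>C (f + g) = c *\<^sub>C f + c *\<^sub>C g" "(c + d) *\<^sub>C f = c *\<^sub>C f + d *\<^sub>C f"
    "c *\<^sub>C d *\<^sub>C f = (c * d) *\<^sub>C f" "r *\<^sub>R f = complex_of_real r *\<^sub>C f"
    by (transfer; auto intro!: blinfun_eqI simp: blinfun_scaleC_apply blinfun.add_left
        blinfun.scaleR_left scaleC_add_right scaleC_add_left scaleC_scaleC scaleR_scaleC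
        simp del: scaleR_conv_of_real)+
  show "norm (c *\<^sub>C f) = cmod c * norm f"
    by transfer (rule norm_blinfun_scaleC)
qed (rule dist_antidual_def sgn_antidual_def uniformity_antidual_def open_antidual_def)+
end

lift_definition cblinfun_compose ::
    "('b::complex_normed_vector, 'c::complex_normed_vector) cblinfun \<Rightarrow>
     ('a::complex_normed_vector, 'b) cblinfun \<Rightarrow> ('a, 'c) cblinfun"
    (infixl "o\<^sub>C\<^sub>L" 67)
  is blinfun_compose
  by simp

section \<open>Hilbert modules and Friedrichs modules\<close>

definition is_adjoint ::
    "('a::complex_hilbert_space, 'a) cblinfun \<Rightarrow> ('a, 'a) cblinfun \<Rightarrow> bool"
  where "is_adjoint S T \<longleftrightarrow> (\<forall>x y. cinner (S *\<^sub>V x) y = cinner x (T *\<^sub>V y))"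

definition cstar_algebra_on :: "('a::complex_hilbert_space, 'a) cblinfun set \<Rightarrow> bool"
  where "cstar_algebra_on A \<longleftrightarrow>
    csubspace A \<and> closed A \<and>
    (\<forall>S\<in>A. \<forall>T\<in>A. S o\<^sub>C\<^sub>L T \<in> A) \<and>
    (\<forall>T\<in>A. \<exists>S\<in>A. is_adjoint S T)"

definition hilbert_module :: "('h::complex_hilbert_space, 'h) cblinfun set \<Rightarrow> bool"
  where "hilbert_module A \<longleftrightarrow>
    cstar_algebra_on A \<and> closure (cspan {M *\<^sub>V u | M u. M \<in> A}) = UNIV"

text \<open>The inclusion of the smaller Hilbert space into the larger one is an explicit map \<open>j\<close>.\<close>

definition friedrichs_module ::
    "('g::complex_hilbert_space, 'h::complex_hilbert_space) cblinfun \<Rightarrow>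
     ('h, 'h) cblinfun set \<Rightarrow> bool"
  where "friedrichs_module j A \<longleftrightarrow>
    hilbert_module A \<and> inj (cblinfun_apply j) \<and> closure (range (cblinfun_apply j)) = UNIV"

text \<open>In the next four definitions \<open>A\<close> and \<open>B\<close> are the multiplier algebras of the source and of the
  target space.\<close>

definition B0_left ::
    "('h::complex_hilbert_space, 'h) cblinfun set \<Rightarrow> ('k::complex_hilbert_space, 'k) cblinfun set \<Rightarrow>
     ('h, 'k) cblinfun set"
  where "B0_left A B = closure (cspan {N o\<^sub>C\<^sub>L T | N T. N \<in> B})"

definition B0_right ::
    "('h::complex_hilbert_space, 'h) cblinfun set \<Rightarrow> ('k::complex_hilbert_space, 'k) cblinfun set \<Rightarrow>
     ('h, 'k) cblinfun set"
  where "B0_right A B = closure (cspan {T o\<^sub>C\<^sub>L M | T M. M \<in> A})"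

definition Bq_left ::
    "('h::complex_hilbert_space, 'h) cblinfun set \<Rightarrow> ('k::complex_hilbert_space, 'k) cblinfun set \<Rightarrow>
     ('h, 'k) cblinfun set"
  where "Bq_left A B = {S. \<forall>M\<in>A. S o\<^sub>C\<^sub>L M \<in> B0_left A B}"

definition Bq_right ::
    "('h::complex_hilbert_space, 'h) cblinfun set \<Rightarrow> ('k::complex_hilbert_space, 'k) cblinfun set \<Rightarrow>
     ('h, 'k) cblinfun set"
  where "Bq_right A B = {S. \<forall>N\<in>B. N o\<^sub>C\<^sub>L S \<in> B0_right A B}"

section \<open>Operators between the spaces of a Gelfand triple\<close>

text \<open>The inclusion of \<open>\<H>\<close> into \<open>\<G>\<^sup>*\<close>: the vector \<open>h\<close> is the form \<open>u \<mapsto> \<langle>j u, h\<rangle>\<close>.\<close>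

lift_definition to_antidual ::
    "('g::complex_hilbert_space, 'h::complex_hilbert_space) cblinfun \<Rightarrow> 'h \<Rightarrow> 'g antidual"
  is "\<lambda>j h. Blinfun (\<lambda>u. cinner (blinfun_apply j u) h)"
  by (simp add: bounded_linear_Blinfun_apply cinner_scaleC_left
      bounded_linear_compose[OF bounded_linear_cinner_left blinfun.bounded_linear_right])

text \<open>The adjoint \<open>D\<^sup>* : \<E>\<^sup>* \<rightarrow> \<G>\<^sup>*\<close>, \<open>\<langle>u, D\<^sup>* f\<rangle> = \<langle>D u, f\<rangle>\<close>.\<close>

lift_definition dual_map ::
    "('g::complex_normed_vector, 'e::complex_normed_vector) cblinfun \<Rightarrow> 'e antidual \<Rightarrow> 'g antidual"
  is "\<lambda>D f. f o\<^sub>L D"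
  by simp

text \<open>The operator \<open>D\<^sup>* a D : \<G> \<rightarrow> \<G>\<^sup>*\<close>.\<close>

definition sandwich ::
    "('g::complex_normed_vector, 'e::complex_normed_vector) cblinfun \<Rightarrow> ('e, 'e antidual) cblinfun \<Rightarrow>
     'g \<Rightarrow> 'g antidual"
  where "sandwich D a u = dual_map D (a *\<^sub>V D *\<^sub>V u)"

text \<open>The operator \<open>\<E> \<rightarrow> \<E>\<^sup>*\<close> induced by an operator \<open>S\<close> in \<open>\<K>\<close>.\<close>

definition induced ::
    "('e::complex_hilbert_space, 'k::complex_hilbert_space) cblinfun \<Rightarrow> ('k, 'k) cblinfun \<Rightarrow>
     'e \<Rightarrow> 'e antidual"
  where "induced j S u = to_antidual j (S *\<^sub>V j *\<^sub>V u)"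

text \<open>The operator in \<open>\<H>\<close> associated to \<open>T : \<G> \<rightarrow> \<G>\<^sup>*\<close>. Its domain is kept as a subset of \<open>\<G>\<close>, so
  that its inverse and resolvents take values in \<open>\<G>\<close>, where \<open>D\<close> is defined.\<close>

definition assoc_dom ::
    "('g::complex_hilbert_space, 'h::complex_hilbert_space) cblinfun \<Rightarrow> ('g \<Rightarrow> 'g antidual) \<Rightarrow> 'g set"
  where "assoc_dom j T = {u. T u \<in> range (to_antidual j)}"

definition assoc_op ::
    "('g::complex_hilbert_space, 'h::complex_hilbert_space) cblinfun \<Rightarrow> ('g \<Rightarrow> 'g antidual) \<Rightarrow> 'g \<Rightarrow> 'h"
  where "assoc_op j T u = the_inv (to_antidual j) (T u)"

definition resolvent ::
    "('g::complex_hilbert_space, 'h::complex_hilbert_space) cblinfun \<Rightarrow> ('g \<Rightarrow> 'g antidual) \<Rightarrow>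
     complex \<Rightarrow> 'h \<Rightarrow> 'g"
  where "resolvent j T z = the_inv_into (assoc_dom j T) (\<lambda>u. assoc_op j T u - z *\<^sub>C (j *\<^sub>V u))"

text \<open>The inverse \<open>(T - z)\<^sup>-\<^sup>1 : \<G>\<^sup>* \<rightarrow> \<G>\<close>, with \<open>\<G> \<subseteq> \<G>\<^sup>*\<close> through \<open>\<H>\<close>.\<close>

definition form_resolvent ::
    "('g::complex_hilbert_space, 'h::complex_hilbert_space) cblinfun \<Rightarrow> ('g \<Rightarrow> 'g antidual) \<Rightarrow>
     complex \<Rightarrow> 'g antidual \<Rightarrow> 'g"
  where "form_resolvent j T z = the_inv (\<lambda>u. T u - z *\<^sub>C to_antidual j (j *\<^sub>V u))"

text \<open>\<open>D (\<Delta>\<^sub>a - z)\<^sup>-\<^sup>1\<close> as a map \<open>\<H> \<rightarrow> \<K>\<close>, and \<open>D (D\<^sup>* a D - z)\<^sup>-\<^sup>1 D\<^sup>*\<close> as a map \<open>\<K> \<rightarrow> \<K>\<close>; here \<open>i\<close> is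
  the inclusion of \<open>\<E>\<close> into \<open>\<K>\<close>.\<close>

definition D_resolvent ::
    "('g::complex_hilbert_space, 'h::complex_hilbert_space) cblinfun \<Rightarrow>
     ('e::complex_hilbert_space, 'k::complex_hilbert_space) cblinfun \<Rightarrow>
     ('g, 'e) cblinfun \<Rightarrow> ('e, 'e antidual) cblinfun \<Rightarrow> complex \<Rightarrow> 'h \<Rightarrow> 'k"
  where "D_resolvent j i D a z f = i *\<^sub>V D *\<^sub>V resolvent j (sandwich D a) z f"

definition D_resolvent_D ::
    "('g::complex_hilbert_space, 'h::complex_hilbert_space) cblinfun \<Rightarrow>
     ('e::complex_hilbert_space, 'k::complex_hilbert_space) cblinfun \<Rightarrow>
     ('g, 'e) cblinfun \<Rightarrow> ('e, 'e antidual) cblinfun \<Rightarrow> complex \<Rightarrow> 'k \<Rightarrow> 'k"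
  where "D_resolvent_D j i D a z f =
    i *\<^sub>V D *\<^sub>V form_resolvent j (sandwich D a) z (dual_map D (to_antidual i f))"

end

theory Submission
  imports Defs
begin

text \<open>Let \<open>S\<close> be the operator inducing \<open>a - c\<close> and \<open>R\<^sub>t\<close> the operator \<open>D (D\<^sup>* b\<^sub>t D - z)\<^sup>-\<^sup>1 D\<^sup>*\<close> for
  \<open>b\<^sub>t = c + t (a - c)\<close>. The forms \<open>b\<^sub>t\<close>, \<open>0 \<le> t \<le> 1\<close>, satisfy the coercivity estimate with the same
  constants, so by Lax-Milgram \<open>R\<^sub>t\<close> exists and is bounded uniformly in \<open>t\<close>. The spaces \<open>B\<^sub>q\<close> over \<open>\<K>\<close> are
  closed subalgebras of the bounded operators, but not stable under adjoints, so invertibility of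
  \<open>1 + R\<^sub>0 S\<close> alone does not put the inverse into them. Instead one moves from \<open>t = 0\<close> to \<open>t = 1\<close> in
  finitely many small steps: by the resolvent identity \<open>R\<^sub>s = R\<^sub>t - (s - t) R\<^sub>s S R\<^sub>t\<close>, the operator
  \<open>R\<^sub>s\<close> is the fixed point of a contraction that preserves \<open>B\<^sub>q\<close> as soon as \<open>R\<^sub>t\<close> lies in \<open>B\<^sub>q\<close> and
  \<open>s - t\<close> is small. Finally \<open>D (\<Delta>\<^sub>a - z)\<^sup>-\<^sup>1 = D (\<Delta>\<^sub>c - z)\<^sup>-\<^sup>1 - R\<^sub>1 S D (\<Delta>\<^sub>c - z)\<^sup>-\<^sup>1\<close>.\<close>

section \<open>Operators and forms\<close>

lemma cblinfun_add_right: "S *\<^sub>V (x + y) = S *\<^sub>V x + S *\<^sub>V y"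
  by transfer (simp add: blinfun.add_right)

lemma cblinfun_scaleC_right: "S *\<^sub>V (r *\<^sub>C x) = r *\<^sub>C (S *\<^sub>V x)"
  by transfer simp

lemma cblinfun_scaleR_right: "S *\<^sub>V (r *\<^sub>R x) = r *\<^sub>R (S *\<^sub>V x)"
  by transfer (simp add: blinfun.scaleR_right)

lemma cblinfun_add_left: "(S + T) *\<^sub>V x = S *\<^sub>V x + T *\<^sub>V x"
  by transfer (simp add: blinfun.add_left)

lemma cblinfun_diff_left: "(S - T) *\<^sub>V x = S *\<^sub>V x - T *\<^sub>V x"
  by transfer (simp add: blinfun.diff_left)

lemma cblinfun_scaleC_left: "(r *\<^sub>C S) *\<^sub>V x = r *\<^sub>C (S *\<^sub>V x)"
  by transfer (simp add: blinfun_scaleC_apply)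

lemma cblinfun_scaleR_left: "(r *\<^sub>R S) *\<^sub>V x = r *\<^sub>R (S *\<^sub>V x)"
  by transfer (simp add: blinfun.scaleR_left)

lemma norm_cblinfun_apply_le: "norm (S *\<^sub>V x) \<le> norm S * norm x"
  by transfer (rule norm_blinfun)

lemma cblinfun_apply_compose: "(S o\<^sub>C\<^sub>L T) *\<^sub>V x = S *\<^sub>V T *\<^sub>V x"
  by transfer simp

lemma cblinfun_eqI: "(\<And>x. S *\<^sub>V x = T *\<^sub>V x) \<Longrightarrow> S = T"
  by transfer (rule blinfun_eqI)

lemma norm_cblinfun_bound:
  "0 \<le> b \<Longrightarrow> (\<And>x. norm (S *\<^sub>V x) \<le> b * norm x) \<Longrightarrow> norm S \<le> b"
  by transfer (rule norm_blinfun_bound)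

lemma bounded_linear_cblinfun_apply: "bounded_linear (cblinfun_apply S)"
  by transfer (rule blinfun.bounded_linear_right)

lemma cblinfun_exists:
  assumes add: "\<And>x y. f (x + y) = f x + f y"
    and scale: "\<And>r x. f (r *\<^sub>C x) = r *\<^sub>C f x"
    and bound: "\<And>x. norm (f x) \<le> K * norm x"
  obtains S where "cblinfun_apply S = f"
proof -
  have bl: "bounded_linear f"
    by (rule bounded_linear_intro[where K = K])
      (simp_all add: add scale scaleR_scaleC bound[THEN order.trans] mult.commute)
  then have "cblinfun_apply (Abs_cblinfun (Blinfun f)) = f"
    by (subst cblinfun_apply.rep_eq, subst Abs_cblinfun_inverse)
      (auto simp: bounded_linear_Blinfun_apply scale)
  then show thesis ..
qed

lemma norm_cblinfun_compose_le: "norm (S o\<^sub>C\<^sub>L T) \<le> norm S * norm T"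
  by transfer (rule norm_blinfun_compose)

lemma cblinfun_compose_assoc: "(S o\<^sub>C\<^sub>L T) o\<^sub>C\<^sub>L U = S o\<^sub>C\<^sub>L (T o\<^sub>C\<^sub>L U)"
  by (rule cblinfun_eqI) (simp add: cblinfun_apply_compose)

lemma cblinfun_compose_add_left: "(S + T) o\<^sub>C\<^sub>L U = S o\<^sub>C\<^sub>L U + T o\<^sub>C\<^sub>L U"
  by (rule cblinfun_eqI) (simp add: cblinfun_apply_compose cblinfun_add_left)

lemma cblinfun_compose_add_right: "S o\<^sub>C\<^sub>L (T + U) = S o\<^sub>C\<^sub>L T + S o\<^sub>C\<^sub>L U"
  by (rule cblinfun_eqI) (simp add: cblinfun_apply_compose cblinfun_add_left cblinfun_add_right)

lemma cblinfun_compose_scaleC_left: "(r *\<^sub>C S) o\<^sub>C\<^sub>L T = r *\<^sub>C (S o\<^sub>C\<^sub>L T)"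
  by (rule cblinfun_eqI) (simp add: cblinfun_apply_compose cblinfun_scaleC_left)

lemma cblinfun_compose_scaleC_right: "S o\<^sub>C\<^sub>L (r *\<^sub>C T) = r *\<^sub>C (S o\<^sub>C\<^sub>L T)"
  by (rule cblinfun_eqI) (simp add: cblinfun_apply_compose cblinfun_scaleC_left cblinfun_scaleC_right)

lemma bounded_linear_compose_left: "bounded_linear (\<lambda>S. S o\<^sub>C\<^sub>L T)"
  by (rule bounded_linear_intro[where K = "norm T"])
    (simp_all add: cblinfun_compose_add_left scaleR_scaleC cblinfun_compose_scaleC_left
      norm_cblinfun_compose_le)

lemma bounded_linear_compose_right: "bounded_linear (\<lambda>T. S o\<^sub>C\<^sub>L T)"
  by (rule bounded_linear_intro[where K = "norm S"])
    (simp_all add: cblinfun_compose_add_right scaleR_scaleC cblinfun_compose_scaleC_right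
      norm_cblinfun_compose_le mult.commute[of _ "norm S"])

lemma antidual_add_left: "antidual_apply (f + g) x = antidual_apply f x + antidual_apply g x"
  by transfer (simp add: blinfun.add_left)

lemma antidual_diff_left: "antidual_apply (f - g) x = antidual_apply f x - antidual_apply g x"
  by transfer (simp add: blinfun.diff_left)

lemma antidual_scaleC_left: "antidual_apply (r *\<^sub>C f) x = r * antidual_apply f x"
  by transfer (simp add: blinfun_scaleC_apply scaleC_complex_def)

lemma antidual_scaleR_left: "antidual_apply (r *\<^sub>R f) x = r * antidual_apply f x"
  by (simp add: scaleR_scaleC antidual_scaleC_left)

lemma antidual_add_right: "antidual_apply f (x + y) = antidual_apply f x + antidual_apply f y"
  by transfer (simp add: blinfun.add_right)

lemma antidual_scaleC_right: "antidual_apply f (r *\<^sub>C x) = cnj r * antidual_apply f x"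
  by transfer simp

lemma antidual_scaleR_right: "antidual_apply f (r *\<^sub>R x) = r * antidual_apply f x"
  by (simp add: scaleR_scaleC antidual_scaleC_right)

lemma cmod_antidual_apply_le: "cmod (antidual_apply f x) \<le> norm f * norm x"
  by transfer (rule norm_blinfun)

lemma Re_antidual_apply_le: "Re (antidual_apply f x) \<le> norm f * norm x"
  by (rule order.trans[OF complex_Re_le_cmod cmod_antidual_apply_le])

lemma bounded_linear_antidual_apply: "bounded_linear (antidual_apply f)"
  by transfer (rule blinfun.bounded_linear_right)

lemma antidual_eqI: "(\<And>x. antidual_apply f x = antidual_apply g x) \<Longrightarrow> f = g"
  by transfer (rule blinfun_eqI)

lemma norm_antidual_bound:
  "0 \<le> b \<Longrightarrow> (\<And>x. cmod (antidual_apply f x) \<le> b * norm x) \<Longrightarrow> norm f \<le> b"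
  by transfer (rule norm_blinfun_bound)

lemma antidual_apply_to_antidual: "antidual_apply (to_antidual j h) u = cinner (j *\<^sub>V u) h"
  by transfer
    (simp add: bounded_linear_Blinfun_apply
      bounded_linear_compose[OF bounded_linear_cinner_left blinfun.bounded_linear_right])

lemma antidual_apply_dual_map: "antidual_apply (dual_map D f) u = antidual_apply f (D *\<^sub>V u)"
  by transfer simp

lemma to_antidual_add: "to_antidual j (x + y) = to_antidual j x + to_antidual j y"
  by (rule antidual_eqI) (simp add: antidual_apply_to_antidual antidual_add_left cinner_add_right)

lemma to_antidual_scaleC: "to_antidual j (r *\<^sub>C x) = r *\<^sub>C to_antidual j x"
  by (rule antidual_eqI) (simp add: antidual_apply_to_antidual antidual_scaleC_left cinner_scaleC_right)

lemma norm_to_antidual_le: "norm (to_antidual j h) \<le> norm j * norm h"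
proof (rule norm_antidual_bound)
  fix u
  have "cmod (cinner (j *\<^sub>V u) h) \<le> norm (j *\<^sub>V u) * norm h"
    by (rule cmod_cinner_le)
  also have "\<dots> \<le> (norm j * norm u) * norm h"
    by (intro mult_right_mono norm_cblinfun_apply_le norm_ge_zero)
  finally show "cmod (antidual_apply (to_antidual j h) u) \<le> norm j * norm h * norm u"
    by (simp add: antidual_apply_to_antidual mult_ac)
qed simp

lemma dual_map_add: "dual_map D (f + g) = dual_map D f + dual_map D g"
  by (rule antidual_eqI) (simp add: antidual_apply_dual_map antidual_add_left)

lemma dual_map_scaleC: "dual_map D (r *\<^sub>C f) = r *\<^sub>C dual_map D f"
  by (rule antidual_eqI) (simp add: antidual_apply_dual_map antidual_scaleC_left)

lemma norm_dual_map_le: "norm (dual_map D f) \<le> norm D * norm f"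
proof (rule norm_antidual_bound)
  fix u
  have "cmod (antidual_apply f (D *\<^sub>V u)) \<le> norm f * norm (D *\<^sub>V u)"
    by (rule cmod_antidual_apply_le)
  also have "\<dots> \<le> norm f * (norm D * norm u)"
    by (intro mult_left_mono norm_cblinfun_apply_le norm_ge_zero)
  finally show "cmod (antidual_apply (dual_map D f) u) \<le> norm D * norm f * norm u"
    by (simp add: antidual_apply_dual_map mult_ac)
qed simp

lemma cinner_diff_right: "cinner x (y - z) = cinner x y - cinner x (z::'a::complex_hilbert_space)"
  using cinner_add_right[of x "y - z" z] by simp

text \<open>Two vectors inducing the same form have the same products with the dense range of
  \<open>j\<close>, hence by continuity with every vector, in particular with their difference. This
  gives \<open>the_inv (to_antidual j)\<close> in \<open>assoc_op\<close> its meaning.\<close>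

lemma inj_to_antidual:
  fixes j :: "('g::complex_hilbert_space, 'h::complex_hilbert_space) cblinfun"
  assumes "closure (range (cblinfun_apply j)) = UNIV"
  shows "inj (to_antidual j)"
proof (rule injI)
  fix x y
  assume eq: "to_antidual j x = to_antidual j y"
  have cont: "continuous_on UNIV (\<lambda>w. cinner w v)" for v :: 'h
    by (rule linear_continuous_on[OF bounded_linear_cinner_left])
  have "closed {w. cinner w x = cinner w y}"
    by (rule closed_Collect_eq[OF cont cont])
  moreover have "range (cblinfun_apply j) \<subseteq> {w. cinner w x = cinner w y}"
    using eq by (auto simp flip: antidual_apply_to_antidual)
  ultimately have "closure (range (cblinfun_apply j)) \<subseteq> {w. cinner w x = cinner w y}"
    by (rule closure_minimal[rotated])
  with assms have all: "cinner w x = cinner w y" for w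
    by auto
  have "cinner (x - y) (x - y) = 0"
    using all by (simp add: cinner_diff_right)
  then show "x = y"
    by (simp add: cinner_self)
qed

section \<open>The lemmas of Riesz and Lax-Milgram\<close>

lemma norm_add_sq:
  "(norm (x + y))\<^sup>2 = (norm x)\<^sup>2 + 2 * Re (cinner x y) + (norm (y::'a::complex_hilbert_space))\<^sup>2"
proof -
  have "complex_of_real ((norm (x + y))\<^sup>2) = cinner x x + cinner x y + cinner y x + cinner y y"
    by (simp only: cinner_self[symmetric]) (simp add: cinner_add_left cinner_add_right)
  then have "(norm (x + y))\<^sup>2 = Re (cinner x x + cinner x y + cinner y x + cinner y y)"
    by (metis Re_complex_of_real)
  moreover have "Re (cinner y x) = Re (cinner x y)"
    by (subst cinner_commute) simp
  ultimately show ?thesis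
    by (simp add: cinner_self)
qed

lemma norm_diff_sq:
  "(norm (x - y))\<^sup>2 = (norm x)\<^sup>2 - 2 * Re (cinner x y) + (norm (y::'a::complex_hilbert_space))\<^sup>2"
  \<comment> \<open>The two instances give \<open>cinner x (- y) = cinner x 0 - cinner x y\<close>
    and \<open>cinner x 0 = 0\<close>.\<close>
  using norm_add_sq[of x "- y"] cinner_diff_right[of x 0 y] cinner_diff_right[of x y y] by simp

lemma quadratic_nonneg_imp_linear_zero:
  fixes b d :: real
  assumes "\<And>t. 0 \<le> t\<^sup>2 * d + t * b" and "0 \<le> d"
  shows "b = 0"
proof (rule ccontr)
  assume "b \<noteq> 0"
  \<comment> \<open>The test point -b / (d + 1) makes sense even for d = 0, and the quadratic takes
    the value -b^2 / (d + 1)^2 there.\<close>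
  define e where "e = d + 1"
  have e: "0 < e" "d = e - 1"
    using assms(2) by (simp_all add: e_def)
  have "0 \<le> (- b / e)\<^sup>2 * d + (- b / e) * b"
    by (rule assms(1))
  also have "\<dots> = - (b\<^sup>2 / e\<^sup>2)"
    using e(1) unfolding e(2) by (simp add: field_simps power2_eq_square)
  also have "\<dots> < 0"
    using \<open>b \<noteq> 0\<close> e by simp
  finally show False by simp
qed

text \<open>The representing vector minimises \<open>\<parallel>u\<parallel>\<^sup>2 - 2 Re f(u)\<close>; minimising sequences are Cauchy by the
  parallelogram law.\<close>

lemma riesz_representation:
  fixes f :: "'a::complex_hilbert_space antidual"
  obtains u where "\<And>v. antidual_apply f v = cinner v u"
proof -
  define F where "F u = (norm u)\<^sup>2 - 2 * Re (antidual_apply f u)" for u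
  define m where "m = Inf (range F)"
  \<comment> \<open>From 2 \<open>norm f\<close> \<open>norm u\<close> <= \<open>norm f\<close>^2 +
    \<open>norm u\<close>^2; hence the infimum is finite.\<close>
  have "- (norm f)\<^sup>2 \<le> F u" for u
    using Re_antidual_apply_le[of f u] sum_squares_bound[of "norm f" "norm u"] by (simp add: F_def)
  then have bdd: "bdd_below (range F)"
    by (auto intro!: bdd_belowI)
  have m_le: "m \<le> F u" for u
    unfolding m_def by (rule cInf_lower[OF _ bdd]) simp
  have "\<exists>u. F u < m + inverse (real (Suc n))" for n
    using cInf_lessD[of "range F" "m + inverse (real (Suc n))"] by (auto simp: m_def)
  then obtain X where X: "F (X n) < m + inverse (real (Suc n))" for n
    by metis
  have dist: "(norm (u - v))\<^sup>2 \<le> 2 * (F u - m) + 2 * (F v - m)" for u v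
  proof -
    \<comment> \<open>The midpoint of u and v competes for the infimum, which bounds the norm of u +
      v from below; the parallelogram law then bounds that of u - v from above.\<close>
    have "F ((1/2) *\<^sub>R (u + v)) = (norm (u + v))\<^sup>2 / 4 - Re (antidual_apply f u) - Re (antidual_apply f v)"
      by (simp add: F_def antidual_scaleR_right antidual_add_right power_divide add_divide_distrib)
    then have "m \<le> (norm (u + v))\<^sup>2 / 4 - Re (antidual_apply f u) - Re (antidual_apply f v)"
      using m_le by metis
    then show ?thesis
      using norm_add_sq[of u v] norm_diff_sq[of u v] by (simp add: F_def field_simps)
  qed
  have "Cauchy X"
  proof (rule metric_CauchyI)
    fix e :: real
    assume "0 < e"
    \<comment> \<open>An excess below e^2 / 4 at both indices makes the bound \<open>dist\<close>
      smaller than e^2.\<close>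
    then obtain N where N: "inverse (real (Suc N)) < e\<^sup>2 / 4"
      using reals_Archimedean[of "e\<^sup>2 / 4"] by auto
    have "dist (X k) (X l) < e" if "N \<le> k" "N \<le> l" for k l
    proof -
      have "F (X n) - m < e\<^sup>2 / 4" if n: "N \<le> n" for n
      proof -
        have "inverse (real (Suc n)) \<le> inverse (real (Suc N))"
          using n by (intro le_imp_inverse_le) auto
        then show ?thesis
          using X[of n] N by linarith
      qed
      from this[of k] this[of l] that have "(norm (X k - X l))\<^sup>2 < e\<^sup>2"
        using dist[of "X k" "X l"] by simp
      then show ?thesis
        using \<open>0 < e\<close> by (simp add: dist_norm power2_less_imp_less)
    qed
    then show "\<exists>M. \<forall>k\<ge>M. \<forall>l\<ge>M. dist (X k) (X l) < e"
      by blast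
  qed
  then obtain u where u: "X \<longlonglongrightarrow> u"
    using Cauchy_convergent convergent_def by blast
  have "(\<lambda>n. F (X n)) \<longlonglongrightarrow> F u"
    unfolding F_def
    by (intro tendsto_intros bounded_linear.tendsto[OF bounded_linear_antidual_apply] u)
  moreover have "(\<lambda>n. m + inverse (real (Suc n))) \<longlonglongrightarrow> m + 0"
    by (intro tendsto_intros LIMSEQ_inverse_real_of_nat)
  ultimately have "F u \<le> m + 0"
    by (rule LIMSEQ_le) (use X less_imp_le in blast)
  then have min: "F u \<le> F v" for v
    using m_le[of v] by simp
  \<comment> \<open>The first variation of F at its minimum in the direction v vanishes. Real
    multiples of v see only real parts; the imaginary parts follow below from the direction
    \<open>\<i> *\<^sub>C v\<close>.\<close>
  have Re_eq: "Re (antidual_apply f v) = Re (cinner v u)" for v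
  proof -
    have "0 \<le> t\<^sup>2 * (norm v)\<^sup>2 + t * (2 * (Re (cinner v u) - Re (antidual_apply f v)))" for t
    proof -
      have "F (t *\<^sub>R v + u) = F u + (t\<^sup>2 * (norm v)\<^sup>2 + t * (2 * (Re (cinner v u) - Re (antidual_apply f v))))"
        by (simp add: F_def norm_add_sq antidual_add_right antidual_scaleR_right power_mult_distrib
            scaleR_scaleC[of t v] cinner_scaleC_left norm_scaleC antidual_scaleC_right ring_distribs)
      then show ?thesis
        using min[of "t *\<^sub>R v + u"] by simp
    qed
    from quadratic_nonneg_imp_linear_zero[OF this] show ?thesis by simp
  qed
  have "antidual_apply f v = cinner v u" for v
    using Re_eq[of v] Re_eq[of "\<i> *\<^sub>C v"]
    by (simp add: complex_eq_iff antidual_scaleC_right cinner_scaleC_left)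
  then show thesis ..
qed

text \<open>Bound the right-hand side by \<open>norm (T u) * norm u\<close> and cancel
  \<open>norm u\<close>. This a priori estimate serves twice: for injectivity in Lax-Milgram and for
  the bound 1 / \<mu> on the inverse.\<close>

lemma coercive_norm_le:
  assumes "\<And>u. \<mu> * (norm u)\<^sup>2 \<le> Re (antidual_apply (T u) u)"
  shows "\<mu> * norm u \<le> norm (T u)"
proof (cases "u = 0")
  case False
  have "\<mu> * (norm u)\<^sup>2 \<le> norm (T u) * norm u"
    by (rule order.trans[OF assms Re_antidual_apply_le])
  then show ?thesis
    using False by (simp add: power2_eq_square)
qed simp

text \<open>Injectivity is the a priori estimate. For surjectivity the Riesz map \<open>J\<close>
  turns T u = f into a fixed point equation for u - \<rho> J (T u - f), a contraction for suitable
  \<rho>.\<close>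

lemma lax_milgram:
  fixes T :: "'a::complex_hilbert_space \<Rightarrow> 'a antidual"
  assumes T: "bounded_linear T" and \<mu>: "0 < \<mu>"
    and coer: "\<And>u. \<mu> * (norm u)\<^sup>2 \<le> Re (antidual_apply (T u) u)"
  shows "bij T"
proof (rule bijI)
  interpret T: bounded_linear T by (rule T)
  show "inj T"
  proof (rule injI)
    fix x y
    assume "T x = T y"
    then have "\<mu> * norm (x - y) \<le> 0"
      using coercive_norm_le[of \<mu> T "x - y", OF coer] by (simp add: T.diff)
    then show "x = y"
      using \<mu> by (simp add: mult_le_0_iff)
  qed
  obtain J where J: "antidual_apply f v = cinner v (J f)" for f :: "'a antidual" and v
    using riesz_representation by metis
  have norm_J: "norm (J f) \<le> norm f" for f
  proof -
    have "(norm (J f))\<^sup>2 = Re (antidual_apply f (J f))"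
      by (simp add: J cinner_self)
    also have "\<dots> \<le> norm f * norm (J f)"
      by (rule Re_antidual_apply_le)
    finally show ?thesis
      by (cases "J f = 0") (simp_all add: power2_eq_square)
  qed
  obtain C0 where C0: "norm (T u) \<le> norm u * C0" for u
    using T.bounded by blast
  \<comment> \<open>Raising the bound of T to at least \<mu> makes C positive and keeps 1 - \<mu>^2
    / C^2 nonnegative.\<close>
  define C where "C = max C0 \<mu>"
  have C: "0 < C" "\<mu> \<le> C" "norm (T u) \<le> C * norm u" for u
  proof -
    have "norm u * C0 \<le> norm u * C"
      by (intro mult_left_mono) (simp_all add: C_def)
    then show "norm (T u) \<le> C * norm u"
      using C0[of u] by (simp add: mult.commute)
  qed (use \<mu> in \<open>auto simp: C_def\<close>)
  \<comment> \<open>This \<rho> minimises 1 - 2 \<rho> \<mu> + \<rho>^2 C^2, the factor that the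
    expansion in \<open>contr\<close> produces; the minimum is q^2.\<close>
  define \<rho> where "\<rho> = \<mu> / C\<^sup>2"
  define q where "q = sqrt (1 - \<mu>\<^sup>2 / C\<^sup>2)"
  have "\<mu>\<^sup>2 / C\<^sup>2 \<le> 1"
    using C \<mu> by (simp add: power_mono)
  then have q: "0 \<le> q" "q < 1" "q\<^sup>2 = 1 - \<mu>\<^sup>2 / C\<^sup>2"
    using C(1) \<mu> by (simp_all add: q_def)
  have contr: "norm (w - \<rho> *\<^sub>R J (T w)) \<le> q * norm w" for w
  proof (rule power2_le_imp_le)
    have "(norm (w - \<rho> *\<^sub>R J (T w)))\<^sup>2
        = (norm w)\<^sup>2 - 2 * \<rho> * Re (antidual_apply (T w) w) + \<rho>\<^sup>2 * (norm (J (T w)))\<^sup>2"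
      by (simp add: norm_diff_sq scaleR_scaleC cinner_scaleC_right norm_scaleC J power_mult_distrib)
    also have "\<dots> \<le> (norm w)\<^sup>2 - 2 * \<rho> * (\<mu> * (norm w)\<^sup>2) + \<rho>\<^sup>2 * (C * norm w)\<^sup>2"
      using C(1) \<mu> coer[of w] order.trans[OF norm_J C(3), of w]
      by (intro add_mono diff_mono mult_left_mono power_mono) (auto simp: \<rho>_def)
    also have "\<dots> = (q * norm w)\<^sup>2"
      unfolding power_mult_distrib q(3) using C(1)
      by (simp add: \<rho>_def field_simps power2_eq_square)
    finally show "(norm (w - \<rho> *\<^sub>R J (T w)))\<^sup>2 \<le> (q * norm w)\<^sup>2" .
  qed (use q in simp)
  \<comment> \<open>\<open>J\<close> arises from a choice of representing vectors, so its
    compatibility with differences comes from their uniqueness.\<close>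
  have J_diff: "J (f - g) = J f - J g" for f g
  proof -
    have "cinner v (J (f - g) - (J f - J g)) = 0" for v
      by (simp add: cinner_diff_right antidual_diff_left flip: J)
    then have "cinner (J (f - g) - (J f - J g)) (J (f - g) - (J f - J g)) = 0" .
    then show ?thesis
      by (simp add: cinner_self)
  qed
  show "surj T"
  proof (unfold surj_def, rule allI)
    fix f
    define \<Phi> where "\<Phi> u = u - \<rho> *\<^sub>R J (T u - f)" for u
    have "dist (\<Phi> u) (\<Phi> v) \<le> q * dist u v" for u v
      using contr[of "u - v"] by (simp add: dist_norm \<Phi>_def J_diff T.diff algebra_simps)
    then obtain u where "\<Phi> u = u"
      using banach_fix_type[of q \<Phi>] q by blast
    then have "J (T u - f) = 0"
      using C(1) \<mu> by (simp add: \<Phi>_def \<rho>_def)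
    then have "antidual_apply (T u) v = antidual_apply f v" for v
      \<comment> \<open>The instance of \<open>cinner_diff_right\<close> states that
        \<open>cinner v 0 = 0\<close>.\<close>
      using J[of "T u - f" v] cinner_diff_right[of v 0 0] by (simp add: antidual_diff_left)
    then show "\<exists>u. f = T u"
      by (metis antidual_eqI)
  qed
qed

section \<open>The spaces of quasi-local operators\<close>

lemma csubspace_diff: "csubspace V \<Longrightarrow> x \<in> V \<Longrightarrow> y \<in> V \<Longrightarrow> x - y \<in> V"
  by (rule module.subspace_diff[OF module_scaleC])

lemma csubspace_scaleR: "csubspace V \<Longrightarrow> x \<in> V \<Longrightarrow> r *\<^sub>R x \<in> V"
  unfolding scaleR_scaleC by (rule module.subspace_scale[OF module_scaleC])

lemma csubspace_closure:
  assumes "csubspace V"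
  shows "csubspace (closure V)"
proof (rule module.subspaceI[OF module_scaleC])
  show "0 \<in> closure V"
    using module.subspace_0[OF module_scaleC assms] closure_subset by blast
next
  fix x y
  assume "x \<in> closure V" "y \<in> closure V"
  then obtain f g where fg: "\<forall>n. f n \<in> V" "f \<longlonglongrightarrow> x" "\<forall>n. g n \<in> V" "g \<longlonglongrightarrow> y"
    unfolding closure_sequential by blast
  then have "\<forall>n. f n + g n \<in> V" "(\<lambda>n. f n + g n) \<longlonglongrightarrow> x + y"
    by (auto intro: tendsto_add module.subspace_add[OF module_scaleC assms])
  then show "x + y \<in> closure V"
    unfolding closure_sequential by (intro exI[of _ "\<lambda>n. f n + g n"]) simp
next
  fix r x
  assume "x \<in> closure V"
  then obtain f where "\<forall>n. f n \<in> V" "f \<longlonglongrightarrow> x"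
    unfolding closure_sequential by blast
  then have "\<forall>n. r *\<^sub>C f n \<in> V" "(\<lambda>n. r *\<^sub>C f n) \<longlonglongrightarrow> r *\<^sub>C x"
    by (auto intro: bounded_linear.tendsto[OF bounded_linear_scaleC_right]
        module.subspace_scale[OF module_scaleC assms])
  then show "r *\<^sub>C x \<in> closure V"
    unfolding closure_sequential by (intro exI[of _ "\<lambda>n. r *\<^sub>C f n"]) simp
qed

lemma csubspace_vimage:
  assumes "bounded_linear f" and "\<And>r x. f (r *\<^sub>C x) = r *\<^sub>C f x" and V: "csubspace V"
  shows "csubspace (f -` V)"
proof -
  interpret bounded_linear f by (rule assms(1))
  show ?thesis
    by (rule module.subspaceI[OF module_scaleC])
      (simp_all add: add zero assms(2) module.subspace_0[OF module_scaleC V]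
        module.subspace_add[OF module_scaleC V] module.subspace_scale[OF module_scaleC V])
qed

lemma closed_bounded_linear_vimage: "bounded_linear f \<Longrightarrow> closed V \<Longrightarrow> closed (f -` V)"
  by (rule continuous_closed_vimage) (auto intro: linear_continuous_at)

text \<open>The preimage of V is again a closed subspace, so it contains the closed span of G once
  it contains G. The composition rules for \<open>B0_left\<close> and \<open>B0_right\<close> below
  all reduce to generators in this way.\<close>

lemma closure_cspan_induct:
  assumes f: "bounded_linear f" "\<And>r x. f (r *\<^sub>C x) = r *\<^sub>C f x"
    and V: "csubspace V" "closed V"
    and G: "\<And>x. x \<in> G \<Longrightarrow> f x \<in> V"
    and x: "x \<in> closure (cspan G)"
  shows "f x \<in> V"
proof -
  have "cspan G \<subseteq> f -` V"
    by (rule module.span_minimal[OF module_scaleC]) (use G csubspace_vimage[OF f V(1)] in auto)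
  then have "closure (cspan G) \<subseteq> f -` V"
    by (rule closure_minimal) (rule closed_bounded_linear_vimage[OF f(1) V(2)])
  with x show ?thesis by auto
qed

lemma csubspace_B0_right: "csubspace (B0_right A B)"
  unfolding B0_right_def by (intro csubspace_closure module.subspace_span[OF module_scaleC])

lemma csubspace_B0_left: "csubspace (B0_left A B)"
  unfolding B0_left_def by (intro csubspace_closure module.subspace_span[OF module_scaleC])

lemma closed_B0_right: "closed (B0_right A B)"
  by (simp add: B0_right_def)

lemma closed_B0_left: "closed (B0_left A B)"
  by (simp add: B0_left_def)

lemma compose_in_B0_right: "M \<in> A \<Longrightarrow> T o\<^sub>C\<^sub>L M \<in> B0_right A B"
  unfolding B0_right_def
  by (rule subsetD[OF closure_subset], rule module.span_base[OF module_scaleC]) blast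

lemma compose_in_B0_left: "N \<in> B \<Longrightarrow> N o\<^sub>C\<^sub>L T \<in> B0_left A B"
  unfolding B0_left_def
  by (rule subsetD[OF closure_subset], rule module.span_base[OF module_scaleC]) blast

text \<open>Reassociating S (T M) = (S T) M turns generators into generators.\<close>

lemma B0_right_compose_left:
  assumes "X \<in> B0_right A B"
  shows "S o\<^sub>C\<^sub>L X \<in> B0_right A C"
proof (rule closure_cspan_induct[where f = "\<lambda>X. S o\<^sub>C\<^sub>L X", OF bounded_linear_compose_right
      cblinfun_compose_scaleC_right csubspace_B0_right closed_B0_right _ assms[unfolded B0_right_def]])
  show "S o\<^sub>C\<^sub>L x \<in> B0_right A C" if "x \<in> {T o\<^sub>C\<^sub>L M |T M. M \<in> A}" for x
    using that by (auto simp: compose_in_B0_right simp flip: cblinfun_compose_assoc)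
qed

lemma B0_left_compose_right:
  assumes "X \<in> B0_left A B"
  shows "X o\<^sub>C\<^sub>L S \<in> B0_left C B"
proof (rule closure_cspan_induct[where f = "\<lambda>X. X o\<^sub>C\<^sub>L S", OF bounded_linear_compose_left
      cblinfun_compose_scaleC_left csubspace_B0_left closed_B0_left _ assms[unfolded B0_left_def]])
  show "x o\<^sub>C\<^sub>L S \<in> B0_left C B" if "x \<in> {N o\<^sub>C\<^sub>L T |N T. N \<in> B}" for x
    using that by (auto simp: compose_in_B0_left cblinfun_compose_assoc)
qed

text \<open>On a generator, (T M) Q = T (M Q), and M Q lies in \<open>B0_right\<close> by the
  definition of \<open>Bq_right\<close>.\<close>

lemma B0_right_compose_Bq_right:
  assumes X: "X \<in> B0_right B C" and Q: "Q \<in> Bq_right A B"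
  shows "X o\<^sub>C\<^sub>L Q \<in> B0_right A C"
proof (rule closure_cspan_induct[where f = "\<lambda>X. X o\<^sub>C\<^sub>L Q", OF bounded_linear_compose_left
      cblinfun_compose_scaleC_left csubspace_B0_right closed_B0_right _ X[unfolded B0_right_def]])
  show "x o\<^sub>C\<^sub>L Q \<in> B0_right A C" if x: "x \<in> {T o\<^sub>C\<^sub>L M |T M. M \<in> B}" for x
  proof -
    obtain T M where "M \<in> B" "x = T o\<^sub>C\<^sub>L M"
      using x by blast
    then show ?thesis
      using Q B0_right_compose_left[of "M o\<^sub>C\<^sub>L Q" A B T C]
      by (simp add: Bq_right_def cblinfun_compose_assoc)
  qed
qed

text \<open>Mirror image: P (N T) = (P N) T with P N in \<open>B0_left\<close>.\<close>

lemma Bq_left_compose_B0_left: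
  assumes P: "P \<in> Bq_left B C" and X: "X \<in> B0_left A B"
  shows "P o\<^sub>C\<^sub>L X \<in> B0_left A C"
proof (rule closure_cspan_induct[where f = "\<lambda>X. P o\<^sub>C\<^sub>L X", OF bounded_linear_compose_right
      cblinfun_compose_scaleC_right csubspace_B0_left closed_B0_left _ X[unfolded B0_left_def]])
  show "P o\<^sub>C\<^sub>L x \<in> B0_left A C" if x: "x \<in> {N o\<^sub>C\<^sub>L T |N T. N \<in> B}" for x
  proof -
    obtain N T where "N \<in> B" "x = N o\<^sub>C\<^sub>L T"
      using x by blast
    then show ?thesis
      using P B0_left_compose_right[of "P o\<^sub>C\<^sub>L N" B C T A]
      by (simp add: Bq_left_def flip: cblinfun_compose_assoc)
  qed
qed

text \<open>For N in the target algebra, N (P Q) = (N P) Q with N P in \<open>B0_right\<close>. With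
  equal algebras this makes the space an algebra; in general it lets operators in K act from the
  left on operators from H to K.\<close>

lemma Bq_right_compose:
  "P \<in> Bq_right B C \<Longrightarrow> Q \<in> Bq_right A B \<Longrightarrow> P o\<^sub>C\<^sub>L Q \<in> Bq_right A C"
  using B0_right_compose_Bq_right[of _ B C Q A]
  by (simp add: Bq_right_def flip: cblinfun_compose_assoc)

lemma Bq_left_compose:
  "P \<in> Bq_left B C \<Longrightarrow> Q \<in> Bq_left A B \<Longrightarrow> P o\<^sub>C\<^sub>L Q \<in> Bq_left A C"
  using Bq_left_compose_B0_left[of P B C _ A]
  by (simp add: Bq_left_def cblinfun_compose_assoc)

text \<open>In this form the space is visibly an intersection of preimages of closed subspaces under
  bounded linear maps, so it is a closed subspace itself.\<close>

lemma Bq_right_vimage: "Bq_right A B = (\<Inter>N\<in>B. (\<lambda>S. N o\<^sub>C\<^sub>L S) -` B0_right A B)"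
  by (auto simp: Bq_right_def)

lemma Bq_left_vimage: "Bq_left A B = (\<Inter>M\<in>A. (\<lambda>S. S o\<^sub>C\<^sub>L M) -` B0_left A B)"
  by (auto simp: Bq_left_def)

lemma csubspace_Bq_right: "csubspace (Bq_right A B)"
  unfolding Bq_right_vimage
  by (rule module.subspace_Inter[OF module_scaleC])
    (auto intro!: csubspace_vimage bounded_linear_compose_right cblinfun_compose_scaleC_right
      csubspace_B0_right)

lemma csubspace_Bq_left: "csubspace (Bq_left A B)"
  unfolding Bq_left_vimage
  by (rule module.subspace_Inter[OF module_scaleC])
    (auto intro!: csubspace_vimage bounded_linear_compose_left cblinfun_compose_scaleC_left
      csubspace_B0_left)

lemma closed_Bq_right: "closed (Bq_right A B)"
  unfolding Bq_right_vimage
  by (intro closed_INT ballI closed_bounded_linear_vimage bounded_linear_compose_right closed_B0_right)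

lemma closed_Bq_left: "closed (Bq_left A B)"
  unfolding Bq_left_vimage
  by (intro closed_INT ballI closed_bounded_linear_vimage bounded_linear_compose_left closed_B0_left)

section \<open>Resolvents of coercive forms\<close>

lemma bounded_linear_dual_map: "bounded_linear (dual_map D)"
  by (rule bounded_linear_intro[where K = "norm D"])
    (simp_all add: dual_map_add scaleR_scaleC dual_map_scaleC norm_dual_map_le mult.commute[of _ "norm D"])

lemma bounded_linear_to_antidual: "bounded_linear (to_antidual j)"
  by (rule bounded_linear_intro[where K = "norm j"])
    (simp_all add: to_antidual_add scaleR_scaleC to_antidual_scaleC norm_to_antidual_le mult.commute[of _ "norm j"])

text \<open>The map that \<open>form_resolvent\<close> inverts, made a function of its own so that
  Lax-Milgram applies to it.\<close>

definition shifted_form ::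
    "('g::complex_hilbert_space, 'h::complex_hilbert_space) cblinfun \<Rightarrow>
     ('g, 'e::complex_hilbert_space) cblinfun \<Rightarrow> ('e, 'e antidual) cblinfun \<Rightarrow>
     complex \<Rightarrow> 'g \<Rightarrow> 'g antidual"
  where "shifted_form j D a z u = sandwich D a u - z *\<^sub>C to_antidual j (j *\<^sub>V u)"

lemma bounded_linear_shifted_form: "bounded_linear (shifted_form j D a z)"
  unfolding shifted_form_def[abs_def] sandwich_def
  by (intro bounded_linear_sub bounded_linear_compose[OF bounded_linear_scaleC_right]
      bounded_linear_compose[OF bounded_linear_dual_map]
      bounded_linear_compose[OF bounded_linear_to_antidual]
      bounded_linear_compose[OF bounded_linear_cblinfun_apply] bounded_linear_cblinfun_apply)

lemma shifted_form_add: "shifted_form j D a z (u + v) = shifted_form j D a z u + shifted_form j D a z v"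
  by (rule linear_add[OF bounded_linear.linear[OF bounded_linear_shifted_form]])

lemma shifted_form_scaleC: "shifted_form j D a z (r *\<^sub>C u) = r *\<^sub>C shifted_form j D a z u"
  by (simp add: shifted_form_def sandwich_def cblinfun_scaleC_right dual_map_scaleC to_antidual_scaleC
      scaleC_diff_right scaleC_scaleC mult.commute)

text \<open>Instantiated for c, for a and for every intermediate form, always with the same \<mu>,
  \<nu> and z, so that the estimates are uniform along the path.\<close>

locale coercive_form =
  fixes j :: "('g::complex_hilbert_space, 'h::complex_hilbert_space) cblinfun"
    and D :: "('g, 'e::complex_hilbert_space) cblinfun"
    and a :: "('e, 'e antidual) cblinfun"
    and \<mu> \<nu> :: real
    and z :: complex
  assumes dense: "closure (range (cblinfun_apply j)) = UNIV"
    and pos: "0 < \<mu>"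
    and coercive: "\<And>u. \<mu> * (norm u)\<^sup>2 - \<nu> * (norm (j *\<^sub>V u))\<^sup>2
        \<le> Re (antidual_apply (a *\<^sub>V D *\<^sub>V u) (D *\<^sub>V u))"
    and shift: "Re z \<le> - \<nu>"
begin

text \<open>The shift contributes -Re z times the squared norm in H, and -Re z >= \<nu> absorbs the
  negative term of the coercivity estimate.\<close>

lemma shifted_coercive: "\<mu> * (norm u)\<^sup>2 \<le> Re (antidual_apply (shifted_form j D a z u) u)"
proof -
  have "Re (antidual_apply (shifted_form j D a z u) u)
      = Re (antidual_apply (a *\<^sub>V D *\<^sub>V u) (D *\<^sub>V u)) - Re z * (norm (j *\<^sub>V u))\<^sup>2"
    by (simp add: shifted_form_def sandwich_def antidual_diff_left antidual_scaleC_left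
        antidual_apply_dual_map antidual_apply_to_antidual cinner_self)
  moreover have "Re z * (norm (j *\<^sub>V u))\<^sup>2 \<le> - \<nu> * (norm (j *\<^sub>V u))\<^sup>2"
    by (intro mult_right_mono shift) simp
  ultimately show ?thesis
    using coercive[of u] by simp
qed

lemma bij_shifted_form: "bij (shifted_form j D a z)"
  by (rule lax_milgram[OF bounded_linear_shifted_form pos shifted_coercive])

abbreviation res :: "'g antidual \<Rightarrow> 'g"
  where "res \<equiv> form_resolvent j (sandwich D a) z"

lemma res_def: "res = the_inv (shifted_form j D a z)"
  by (simp add: form_resolvent_def shifted_form_def[abs_def])

lemma shifted_form_res: "shifted_form j D a z (res f) = f"
  unfolding res_def using bij_shifted_form by (simp add: bij_def f_the_inv_into_f)

lemma res_eqI: "shifted_form j D a z u = f \<Longrightarrow> res f = u"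
  unfolding res_def using bij_shifted_form by (auto simp: bij_def the_inv_f_f)

lemma res_add: "res (f + g) = res f + res g"
  by (rule res_eqI) (simp add: shifted_form_add shifted_form_res)

lemma res_scaleC: "res (r *\<^sub>C f) = r *\<^sub>C res f"
  by (rule res_eqI) (simp add: shifted_form_scaleC shifted_form_res)

lemma norm_res_le: "norm (res f) \<le> norm f / \<mu>"
  using coercive_norm_le[of \<mu> "shifted_form j D a z" "res f", OF shifted_coercive] pos
  by (simp add: shifted_form_res field_simps)

text \<open>The resolvent of the associated operator is the restriction to H of the inverse on the
  antidual, so one identity on the antidual handles both operators of the theorem.\<close>

lemma resolvent_eq_res: "resolvent j (sandwich D a) z h = res (to_antidual j h)"
proof -
  have inj: "inj (to_antidual j)"
    by (rule inj_to_antidual[OF dense])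
  \<comment> \<open>Outside its domain \<open>assoc_op\<close> has no meaningful value, so
    membership in the domain is part of the equivalence. In the proof, the z-term moves to the
    right-hand side before the embedding of H is inverted.\<close>
  have op_iff: "u \<in> assoc_dom j (sandwich D a) \<and> assoc_op j (sandwich D a) u - z *\<^sub>C (j *\<^sub>V u) = k
      \<longleftrightarrow> shifted_form j D a z u = to_antidual j k" for u k
  proof -
    have "u \<in> assoc_dom j (sandwich D a) \<and> assoc_op j (sandwich D a) u = k + z *\<^sub>C (j *\<^sub>V u)
        \<longleftrightarrow> sandwich D a u = to_antidual j (k + z *\<^sub>C (j *\<^sub>V u))"
      using inj by (auto simp: assoc_dom_def assoc_op_def the_inv_f_f)
    then show ?thesis
      by (simp add: shifted_form_def to_antidual_add to_antidual_scaleC diff_eq_eq)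
  qed
  have "inj_on (\<lambda>u. assoc_op j (sandwich D a) u - z *\<^sub>C (j *\<^sub>V u)) (assoc_dom j (sandwich D a))"
    by (rule inj_onI) (metis op_iff res_eqI)
  moreover have "res (to_antidual j h) \<in> assoc_dom j (sandwich D a)
      \<and> assoc_op j (sandwich D a) (res (to_antidual j h)) - z *\<^sub>C (j *\<^sub>V res (to_antidual j h)) = h"
    unfolding op_iff by (rule shifted_form_res)
  ultimately show ?thesis
    unfolding resolvent_def by (intro the_inv_into_f_eq) auto
qed

lemma D_resolvent_eq: "D_resolvent j i D a z h = i *\<^sub>V D *\<^sub>V res (to_antidual j h)"
  by (simp add: D_resolvent_def resolvent_eq_res)

text \<open>The chain K -> E* -> G* -> G -> E -> K contributes the norms of \<open>i\<close> and D
  twice and 1 / \<mu> once. The bound does not involve the form a, which is what the continuation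
  requires.\<close>

lemma D_resolvent_D_operator:
  obtains R where "cblinfun_apply R = D_resolvent_D j i D a z" "norm R \<le> (norm i * norm D)\<^sup>2 / \<mu>"
proof -
  have bound: "norm (D_resolvent_D j i D a z f) \<le> (norm i * norm D)\<^sup>2 / \<mu> * norm f" for f
  proof -
    have "norm (D_resolvent_D j i D a z f)
        \<le> norm i * (norm D * norm (res (dual_map D (to_antidual i f))))"
      unfolding D_resolvent_D_def
      by (rule order.trans[OF norm_cblinfun_apply_le])
        (intro mult_left_mono norm_cblinfun_apply_le norm_ge_zero)
    also have "\<dots> \<le> norm i * (norm D * (norm (dual_map D (to_antidual i f)) / \<mu>))"
      by (intro mult_left_mono norm_res_le norm_ge_zero)
    also have "\<dots> \<le> norm i * (norm D * (norm D * (norm i * norm f) / \<mu>))"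
      using pos
      by (intro mult_left_mono divide_right_mono norm_ge_zero order.trans[OF norm_dual_map_le]
          norm_to_antidual_le) auto
    finally show ?thesis
      by (simp add: power2_eq_square mult_ac)
  qed
  have "D_resolvent_D j i D a z (f + g) = D_resolvent_D j i D a z f + D_resolvent_D j i D a z g"
    "D_resolvent_D j i D a z (r *\<^sub>C f) = r *\<^sub>C D_resolvent_D j i D a z f" for f g r
    by (simp_all add: D_resolvent_D_def to_antidual_add to_antidual_scaleC dual_map_add
        dual_map_scaleC res_add res_scaleC cblinfun_add_right cblinfun_scaleC_right)
  then obtain R where R: "cblinfun_apply R = D_resolvent_D j i D a z"
    using cblinfun_exists[of "D_resolvent_D j i D a z", OF _ _ bound] by blast
  moreover have "norm R \<le> (norm i * norm D)\<^sup>2 / \<mu>"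
    by (rule norm_cblinfun_bound) (use pos bound in \<open>simp_all add: R\<close>)
  ultimately show thesis ..
qed

end

section \<open>Resolvent identity, continuation along a path of forms, and the perturbation
  theorem\<close>

lemma second_resolvent_identity:
  assumes "coercive_form j D a \<mu> \<nu> z" and "coercive_form j D b \<mu> \<nu> z"
    and ab: "\<And>x. b *\<^sub>V x = a *\<^sub>V x + r *\<^sub>R induced i S x"
  shows "form_resolvent j (sandwich D a) z f = form_resolvent j (sandwich D b) z f
    + r *\<^sub>R form_resolvent j (sandwich D b) z (dual_map D (to_antidual i
        (S *\<^sub>V i *\<^sub>V D *\<^sub>V form_resolvent j (sandwich D a) z f)))"
proof -
  interpret a: coercive_form j D a \<mu> \<nu> z by (rule assms(1))
  interpret b: coercive_form j D b \<mu> \<nu> z by (rule assms(2))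
  define w where "w = dual_map D (to_antidual i (S *\<^sub>V i *\<^sub>V D *\<^sub>V a.res f))"
  \<comment> \<open>The resolvent of a nearly solves the equation for b: the error is r w, so
    applying the resolvent of b to f + r w returns \<open>a.res f\<close>.\<close>
  have "shifted_form j D b z (a.res f) = shifted_form j D a z (a.res f) + complex_of_real r *\<^sub>C w"
    by (simp add: shifted_form_def sandwich_def ab induced_def dual_map_add scaleR_scaleC dual_map_scaleC
        w_def)
  then have "a.res f = b.res (f + complex_of_real r *\<^sub>C w)"
    by (intro b.res_eqI[symmetric]) (simp add: a.shifted_form_res)
  then show ?thesis
    by (simp add: b.res_add b.res_scaleC scaleR_scaleC w_def)
qed

text \<open>One step of the continuation: \<open>P \<mapsto> R - P Y\<close> contracts towards \<open>R'\<close> and leaves \<open>A\<close> invariant.\<close>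

lemma fixed_point_in_closed_subspace:
  assumes A: "csubspace A" "closed A" "\<And>S T. S \<in> A \<Longrightarrow> T \<in> A \<Longrightarrow> S o\<^sub>C\<^sub>L T \<in> A"
    and "R \<in> A" "Y \<in> A" "norm Y < 1" and R': "R' = R - R' o\<^sub>C\<^sub>L Y"
  shows "R' \<in> A"
proof -
  have ne: "A \<noteq> {}"
    using \<open>R \<in> A\<close> by blast
  have le: "infdist R' A \<le> dist R' P * norm Y" if "P \<in> A" for P
  proof -
    have "R - P o\<^sub>C\<^sub>L Y \<in> A"
      using that assms by (intro csubspace_diff) auto
    then have "infdist R' A \<le> dist R' (R - P o\<^sub>C\<^sub>L Y)"
      by (rule infdist_le)
    \<comment> \<open>The fixed point equation gives R' - (R - P Y) = (P - R') Y.\<close>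
    also have "\<dots> = norm ((P - R') o\<^sub>C\<^sub>L Y)"
      by (subst R')
        (simp add: dist_norm linear_diff[OF bounded_linear.linear[OF bounded_linear_compose_left]])
    also have "\<dots> \<le> dist R' P * norm Y"
      by (simp add: dist_norm norm_minus_commute norm_cblinfun_compose_le)
    finally show ?thesis .
  qed
  \<comment> \<open>The infimum over P in \<open>le\<close> gives d <= \<open>norm Y\<close> d for
    the distance d of R' from A, and \<open>norm Y\<close> < 1 forces d = 0. The case distinction
    allows division by \<open>norm Y\<close>.\<close>
  have "infdist R' A = 0"
  proof (cases "norm Y = 0")
    case True
    with le[OF \<open>R \<in> A\<close>] show ?thesis
      using infdist_nonneg[of R' A] by simp
  next
    case False
    have "infdist R' A / norm Y \<le> dist R' P" if "P \<in> A" for P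
      using le[OF that] False by (simp add: field_simps)
    then have "infdist R' A / norm Y \<le> (INF P\<in>A. dist R' P)"
      by (rule cINF_greatest[OF ne])
    then have "infdist R' A / norm Y \<le> infdist R' A"
      using infdist_notempty[OF ne, of R'] by simp
    then have "infdist R' A * (1 - norm Y) \<le> 0"
      using False by (simp add: field_simps)
    then show ?thesis
      using \<open>norm Y < 1\<close> infdist_nonneg[of R' A] by (simp add: mult_le_0_iff)
  qed
  then show ?thesis
    using in_closed_iff_infdist_zero[OF A(2) ne] by simp
qed

text \<open>Because B bounds all R t at once, one step length 1 / N is small enough everywhere on
  the path, and N steps lead from 0 to 1.\<close>

lemma continuation_in_subalgebra:
  assumes A: "csubspace A" "closed A" "\<And>S T. S \<in> A \<Longrightarrow> T \<in> A \<Longrightarrow> S o\<^sub>C\<^sub>L T \<in> A"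
    and S: "S \<in> A" and R0: "R 0 \<in> A"
    and bound: "\<And>t. t \<in> {0..1} \<Longrightarrow> norm (R t) \<le> B"
    and identity: "\<And>s t. s \<in> {0..1} \<Longrightarrow> t \<in> {0..1} \<Longrightarrow>
        R s = R t - (s - t) *\<^sub>R (R s o\<^sub>C\<^sub>L (S o\<^sub>C\<^sub>L R t))"
  shows "R (1::real) \<in> A"
proof -
  obtain N :: nat where N: "norm S * B < real N"
    using reals_Archimedean2 by blast
  \<comment> \<open>B is nonnegative since it bounds a norm; this makes N positive, so that dividing
    by N is harmless.\<close>
  have "0 \<le> norm S * B"
    using bound[of 0] by (intro mult_nonneg_nonneg) (auto intro: order.trans[OF norm_ge_zero])
  with N have "0 < N"
    by (cases N) auto
  have "k \<le> N \<Longrightarrow> R (real k / real N) \<in> A" for k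
  proof (induction k)
    case 0
    then show ?case using R0 by simp
  next
    case (Suc k)
    define s t where "s = real (Suc k) / real N" and "t = real k / real N"
    have st: "s \<in> {0..1}" "t \<in> {0..1}" "s - t = 1 / real N"
      using Suc.prems \<open>0 < N\<close> by (auto simp: s_def t_def field_simps)
    \<comment> \<open>With this Y in A the identity reads R s = R t - R s Y, and the choice of N
      gives \<open>norm Y\<close> < 1.\<close>
    define Y where "Y = (s - t) *\<^sub>R (S o\<^sub>C\<^sub>L R t)"
    have Rt: "R t \<in> A"
      using Suc by (simp add: t_def)
    have "R s \<in> A"
    proof (rule fixed_point_in_closed_subspace[OF A Rt])
      show "Y \<in> A"
        unfolding Y_def by (intro csubspace_scaleR A S Rt)
      have "norm Y \<le> norm S * norm (R t) / real N"
        using \<open>0 < N\<close> norm_cblinfun_compose_le[of S "R t"] by (simp add: Y_def st(3) divide_right_mono)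
      also have "\<dots> \<le> norm S * B / real N"
        by (intro divide_right_mono mult_left_mono bound st) auto
      also have "\<dots> < 1"
        using N \<open>0 < N\<close> by simp
      finally show "norm Y < 1" .
      show "R s = R t - R s o\<^sub>C\<^sub>L Y"
        using identity[OF st(1,2)]
        by (simp add: Y_def scaleR_scaleC cblinfun_compose_scaleC_right)
    qed
    then show ?case by (simp add: s_def)
  qed
  from this[of N] \<open>0 < N\<close> show ?thesis by simp
qed

text \<open>Both versions of the theorem are covered at once: A stands for a closed algebra of
  operators in K, and Q for a space of operators from H to K on which A acts from the left.\<close>

lemma resolvent_perturbation:
  fixes a c :: "('e::complex_hilbert_space, 'e antidual) cblinfun"
    and D :: "('g::complex_hilbert_space, 'e) cblinfun"
    and j :: "('g, 'h::complex_hilbert_space) cblinfun"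
    and i :: "('e, 'k::complex_hilbert_space) cblinfun"
  assumes a: "coercive_form j D a \<mu> \<nu> z" and c: "coercive_form j D c \<mu> \<nu> z"
    and A: "csubspace A" "closed A" "\<And>S T. S \<in> A \<Longrightarrow> T \<in> A \<Longrightarrow> S o\<^sub>C\<^sub>L T \<in> A"
    and Q: "csubspace Q" "\<And>S T. S \<in> A \<Longrightarrow> T \<in> Q \<Longrightarrow> S o\<^sub>C\<^sub>L T \<in> Q"
    and Qc: "D_resolvent j i D c z \<in> cblinfun_apply ` Q"
    and Rc: "D_resolvent_D j i D c z \<in> cblinfun_apply ` A"
    and V: "cblinfun_apply (a - c) \<in> induced i ` A"
  shows "D_resolvent j i D a z \<in> cblinfun_apply ` Q \<and> D_resolvent_D j i D a z \<in> cblinfun_apply ` A"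
proof -
  interpret a: coercive_form j D a \<mu> \<nu> z by (rule a)
  interpret c: coercive_form j D c \<mu> \<nu> z by (rule c)
  obtain S where S: "S \<in> A" "cblinfun_apply (a - c) = induced i S"
    using V by blast
  define b where "b t = c + t *\<^sub>R (a - c)" for t
  \<comment> \<open>\<open>b t\<close> is the convex combination (1 - t) c + t a, and both forms
    have the same lower bound m.\<close>
  have b: "coercive_form j D (b t) \<mu> \<nu> z" if "t \<in> {0..1}" for t
  proof
    fix u
    define m where "m = \<mu> * (norm u)\<^sup>2 - \<nu> * (norm (j *\<^sub>V u))\<^sup>2"
    define \<alpha> \<gamma> where "\<alpha> = Re (antidual_apply (a *\<^sub>V D *\<^sub>V u) (D *\<^sub>V u))"
      and "\<gamma> = Re (antidual_apply (c *\<^sub>V D *\<^sub>V u) (D *\<^sub>V u))"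
    have "m \<le> \<alpha>" "m \<le> \<gamma>"
      using a.coercive c.coercive by (auto simp: m_def \<alpha>_def \<gamma>_def)
    then have "t * m \<le> t * \<alpha>" "(1 - t) * m \<le> (1 - t) * \<gamma>"
      using that by (auto intro: mult_left_mono)
    then have "m \<le> (1 - t) * \<gamma> + t * \<alpha>"
      by (simp add: algebra_simps)
    also have "\<dots> = Re (antidual_apply (b t *\<^sub>V D *\<^sub>V u) (D *\<^sub>V u))"
      by (simp add: b_def \<alpha>_def \<gamma>_def cblinfun_add_left cblinfun_diff_left cblinfun_scaleR_left
          antidual_add_left antidual_diff_left antidual_scaleR_left algebra_simps)
    finally show "\<mu> * (norm u)\<^sup>2 - \<nu> * (norm (j *\<^sub>V u))\<^sup>2
        \<le> Re (antidual_apply (b t *\<^sub>V D *\<^sub>V u) (D *\<^sub>V u))"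
      by (simp add: m_def)
  qed (fact a.dense a.pos a.shift)+
  have b_diff: "b s *\<^sub>V x = b t *\<^sub>V x + (s - t) *\<^sub>R induced i S x" for s t x
    by (simp add: b_def cblinfun_add_left cblinfun_scaleR_left S(2) flip: scaleR_left.add)
  \<comment> \<open>The choice picks a bounded operator representing the map; it is meaningful for t
    in [0,1], where \<open>D_resolvent_D_operator\<close> supplies one.\<close>
  define R where "R t = (SOME R. cblinfun_apply R = D_resolvent_D j i D (b t) z
      \<and> norm R \<le> (norm i * norm D)\<^sup>2 / \<mu>)" for t
  have R: "cblinfun_apply (R t) = D_resolvent_D j i D (b t) z
      \<and> norm (R t) \<le> (norm i * norm D)\<^sup>2 / \<mu>" if "t \<in> {0..1}" for t
    unfolding R_def
    by (rule someI_ex) (metis coercive_form.D_resolvent_D_operator[OF b[OF that]])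
  have R_apply: "R t *\<^sub>V f = i *\<^sub>V D *\<^sub>V form_resolvent j (sandwich D (b t)) z
      (dual_map D (to_antidual i f))" if "t \<in> {0..1}" for t f
    using R[OF that] by (simp add: D_resolvent_D_def)
  have [simp]: "b 0 = c" "b 1 = a"
    by (simp_all add: b_def)
  have "R 1 \<in> A"
  proof (rule continuation_in_subalgebra[where R = R and B = "(norm i * norm D)\<^sup>2 / \<mu>", OF A S(1)])
    \<comment> \<open>\<open>R 0\<close> was chosen independently of the hypothesis on c; it is the
      operator given there because the two agree on every vector.\<close>
    obtain U where "U \<in> A" "cblinfun_apply U = D_resolvent_D j i D c z"
      using Rc by force
    moreover from this have "R 0 = U"
      using R[of 0] by (intro cblinfun_eqI) simp
    ultimately show "R 0 \<in> A" by simp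
  next
    fix s t :: real
    assume st: "s \<in> {0..1}" "t \<in> {0..1}"
    \<comment> \<open>The resolvent identity from \<open>b t\<close> to \<open>b s\<close>, whose
      difference is induced by (s - t) S; the factor R s on the left is the unknown of the step from
      t to s.\<close>
    have "R t = R s + (s - t) *\<^sub>R (R s o\<^sub>C\<^sub>L (S o\<^sub>C\<^sub>L R t))"
    proof (rule cblinfun_eqI)
      fix f
      show "R t *\<^sub>V f = (R s + (s - t) *\<^sub>R (R s o\<^sub>C\<^sub>L (S o\<^sub>C\<^sub>L R t))) *\<^sub>V f"
        unfolding cblinfun_add_left cblinfun_scaleR_left cblinfun_apply_compose
          R_apply[OF st(1)] R_apply[OF st(2)]
        by (subst second_resolvent_identity[OF b[OF st(2)] b[OF st(1)] b_diff])
          (simp add: cblinfun_add_right cblinfun_scaleR_right)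
    qed
    then show "R s = R t - (s - t) *\<^sub>R (R s o\<^sub>C\<^sub>L (S o\<^sub>C\<^sub>L R t))"
      by (metis add_diff_cancel_right')
  next
    show "norm (R t) \<le> (norm i * norm D)\<^sup>2 / \<mu>" if "t \<in> {0..1}" for t
      using R[OF that] ..
  qed
  obtain U where U: "U \<in> Q" "cblinfun_apply U = D_resolvent j i D c z"
    using Qc by force
  have ac: "a *\<^sub>V x = c *\<^sub>V x + 1 *\<^sub>R induced i S x" for x
    using b_diff[of 1 x 0] by simp
  have "D_resolvent j i D a z = cblinfun_apply (U - R 1 o\<^sub>C\<^sub>L (S o\<^sub>C\<^sub>L U))"
  proof
    fix h
    \<comment> \<open>The same identity from c to a with r = 1, applied to the form of h. It
      expresses the unknown operator through U in Q and \<open>R 1\<close>, S in A.\<close>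
    have "U *\<^sub>V h = D_resolvent j i D a z h + R 1 *\<^sub>V S *\<^sub>V U *\<^sub>V h"
      unfolding U(2) a.D_resolvent_eq c.D_resolvent_eq
      by (subst second_resolvent_identity[OF c a ac])
        (simp add: R_apply cblinfun_add_right)
    then show "D_resolvent j i D a z h = (U - R 1 o\<^sub>C\<^sub>L (S o\<^sub>C\<^sub>L U)) *\<^sub>V h"
      by (simp add: cblinfun_diff_left cblinfun_apply_compose eq_diff_eq)
  qed
  moreover have "U - R 1 o\<^sub>C\<^sub>L (S o\<^sub>C\<^sub>L U) \<in> Q"
    by (intro csubspace_diff Q U \<open>R 1 \<in> A\<close> S)
  moreover have "D_resolvent_D j i D a z = cblinfun_apply (R 1)"
    using R[of 1] by simp
  ultimately show ?thesis
    using \<open>R 1 \<in> A\<close> by blast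
qed

theorem proposition3p7:
  fixes j :: "('g::complex_hilbert_space, 'h::complex_hilbert_space) cblinfun"
    and i :: "('e::complex_hilbert_space, 'k::complex_hilbert_space) cblinfun"
    and MH :: "('h, 'h) cblinfun set"
    and MK :: "('k, 'k) cblinfun set"
    and D :: "('g, 'e) cblinfun"
    and a c :: "('e, 'e antidual) cblinfun"
    and \<mu> \<nu> :: real
    and z :: complex
  assumes "friedrichs_module j MH" and "friedrichs_module i MK"
    and "\<mu> > 0" and "\<nu> > 0"
    and "\<And>u. Re (antidual_apply (a *\<^sub>V D *\<^sub>V u) (D *\<^sub>V u)) \<ge> \<mu> * (norm u)\<^sup>2 - \<nu> * (norm (j *\<^sub>V u))\<^sup>2"
    and "\<And>u. Re (antidual_apply (c *\<^sub>V D *\<^sub>V u) (D *\<^sub>V u)) \<ge> \<mu> * (norm u)\<^sup>2 - \<nu> * (norm (j *\<^sub>V u))\<^sup>2"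
    and "Re z \<le> - \<nu>"
  shows "(D_resolvent j i D c z \<in> cblinfun_apply ` Bq_right MH MK \<and>
          D_resolvent_D j i D c z \<in> cblinfun_apply ` Bq_right MK MK \<and>
          cblinfun_apply (a - c) \<in> induced i ` Bq_right MK MK \<longrightarrow>
          D_resolvent j i D a z \<in> cblinfun_apply ` Bq_right MH MK \<and>
          D_resolvent_D j i D a z \<in> cblinfun_apply ` Bq_right MK MK) \<and>
         (D_resolvent j i D c z \<in> cblinfun_apply ` Bq_left MH MK \<and>
          D_resolvent_D j i D c z \<in> cblinfun_apply ` Bq_left MK MK \<and>
          cblinfun_apply (a - c) \<in> induced i ` Bq_left MK MK \<longrightarrow>
          D_resolvent j i D a z \<in> cblinfun_apply ` Bq_left MH MK \<and>
          D_resolvent_D j i D a z \<in> cblinfun_apply ` Bq_left MK MK)"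
proof -
  have a: "coercive_form j D a \<mu> \<nu> z" and c: "coercive_form j D c \<mu> \<nu> z"
    using assms by (simp_all add: coercive_form_def friedrichs_module_def)
  show ?thesis
    \<comment> \<open>Unification takes the quasi-local operators in K for A and those from H to K
      for Q; the composition rules give both the algebra property and the action.\<close>
    by (rule conjI; rule impI; elim conjE; rule resolvent_perturbation[OF a c])
      (assumption | rule csubspace_Bq_right closed_Bq_right Bq_right_compose
        csubspace_Bq_left closed_Bq_left Bq_left_compose)+
qed

end
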